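(* Let $n\ge2$, let $h$ be the euclidean metric on $\mathbb{R}^{n-1}$, and let ${\not\!\!D}^{res}_{k}(h;\lambda)$ be the residue family operators on spinors of the flat space $(\mathbb{R}^{n-1},h)$. For integers $N\ge1$ and $0\le M\le N-1$, $${\not\!\!D}^{res}_{2N}\big(h;2N-\tfrac n2-M\big)=e_n\cdot D_{\mathcal T}^{2M+1}\,{\not\!\!D}^{res}_{2N-2M-1}\big(h;2N-\tfrac n2-M\big),$$ and for integers $N\ge1$ and $0\le M\le N$, $${\not\!\!D}^{res}_{2N+1}\big(h;2N+1-\tfrac n2-M\big)=e_n\cdot D_{\mathcal T}^{2M+1}\,{\not\!\!D}^{res}_{2N-2M}\big(h;2N+1-\tfrac n2-M\big).$$
   Context: Clifford and spinor conventions. $e_1,\dots,e_n$ is the standard basis of euclidean $\mathbb{R}^n$, with Clifford relations $e_i\cdot e_j+e_j\cdot e_i=-2\delta_{ij}$; $\Delta_n$ is the complex spinor module. Spinors on $\mathbb{R}^n_{x_n\ge 0}$ are smooth $\Delta_n$-valued functions. The boundary $\mathbb{R}^{n-1}=\{x_n=0\}$ carries the euclidean metric $h$; sections of the spinor bundle of $\mathbb{R}^n$ restricted to $\{x_n=0\}$ are smooth $\Delta_n$-valued functions on $\mathbb{R}^{n-1}$, and $\iota^*$ is the restriction of spinors to $x_n=0$. Put $$D_{\mathcal T}=\sum_{i=1}^{n-1}e_i\cdot\partial_i,\qquad \widetilde{\not\!\!D}=e_n\cdot\sum_{i=1}^{n-1}e_i\cdot\partial_i ,$$ acting on spinors on $\mathbb{R}^n_{x_n\ge0}$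 and on $\Delta_n$-valued functions on $\mathbb{R}^{n-1}$. Pochhammer symbol: $(a)_l=a(a+1)\cdots(a+l-1)$, $(a)_0=1$. Solution operators of the flat space (the coefficients of formal asymptotic eigenspinors of the hyperbolic Dirac operator), rational in $\lambda$: for $l\in\mathbb{N}_0$, $$\mathcal T_{2l}(h;\lambda)=\frac{1}{2^{2l}\,l!\,(\frac12+\lambda)_l}\widetilde{\not\!\!D}^{2l},\qquad \mathcal T_{2l+1}(h;\lambda)=\frac{1}{2^{2l+1}\,l!\,(\frac12+\lambda)_{l+1}}\widetilde{\not\!\!D}^{2l+1}.$$ Define, for $N\in\mathbb{N}_0$, $${\not\!\delta}_N(h;\lambda)=\sum_{j=0}^N\frac{1}{(N-j)!}\,\mathcal T_j(h;\lambda)\,\iota^*\partial_n^{N-j}.$$ Residue family operators (the boundary has dimension $n-1$): $${\not\!\!D}^{res}_{2N}(h;\lambda)=2^{2N}N!\Big[\prod_{k=0}^{N-1}(\lambda+\tfrac n2-2N+k)\Big]{\not\!\delta}_{2N}(h;\lambda+\tfrac{n-1}{2}-2N),$$ $${\not\!\!D}^{res}_{2N+1}(h;\lambda)=2^{2N+1}N!\Big[\prod_{k=0}^{N}(\lambda+\tfrac n2-2N-1+k)\Big]{\not\!\delta}_{2N+1}(h;\lambda+\tfrac{n-1}{2}-2N-1).$$ The prefactors cancel all poles, so these are polynomial in $\lambda$ (values at poles of ${\not\!\delta}$ are understood by polynomial continuation). They map spinors on $\mathbb{R}^n_{x_n\ge0}$ to $\Delta_n$-valued functions on $\mathbb{R}^{n-1}$.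 Empty products are $1$; in particular ${\not\!\!D}^{res}_0(h;\lambda)=\iota^*$. *)

theory Defs
  imports "HOL-Analysis.Analysis" "HOL-Computational_Algebra.Polynomial"
begin

text \<open>
  Euclidean space \<open>\<real>\<^sup>n\<close> is \<open>(real ^ 'm) \<times> real\<close> with \<open>n = CARD('m) + 1\<close>; the second
  component is the coordinate \<open>x\<^sub>n\<close>. The standard basis is indexed by \<^typ>\<open>'m option\<close>,
  where \<^term>\<open>None\<close> is the index \<open>n\<close>.

  The spinor module is given by matrices \<open>e i\<close> acting on column vectors. Over the complex numbers
  every Clifford module of dimension \<open>2 ^ (n div 2)\<close> is irreducible, and every irreducible one
  has this dimension, so the predicate describes all models of the spinor module (for odd \<open>n\<close>,
  both of the inequivalent ones).
\<close>

definition spinor_module :: "nat \<Rightarrow> ('m::finite option \<Rightarrow> complex ^ 's ^ 's::finite) \<Rightarrow> bool" where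
  "spinor_module n e \<longleftrightarrow>
     CARD('s) = 2 ^ (n div 2) \<and>
     (\<forall>i j. e i ** e j + e j ** e i = mat (if i = j then - 2 else 0))"

definition halfspace :: "((real ^ 'm::finite) \<times> real) set" where
  "halfspace = {x. snd x \<ge> 0}"

text \<open>
  Derivative along \<open>v\<close> using only values on \<open>S\<close>: it is one-sided in the normal direction at
  boundary points of the half-space.
\<close>

definition partial_on ::
    "'a::real_normed_vector set \<Rightarrow> 'a \<Rightarrow> ('a \<Rightarrow> 'b::real_normed_vector) \<Rightarrow> 'a \<Rightarrow> 'b" where
  "partial_on S v f x =
     vector_derivative (\<lambda>t::real. f (x + t *\<^sub>R v)) (at 0 within {t. x + t *\<^sub>R v \<in> S})"

text \<open>
  Smoothness on \<open>S\<close>, meant for open sets and closed half-spaces; in the latter case it is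
  smoothness up to the boundary.
\<close>

fun Ck_on :: "nat \<Rightarrow> 'a::euclidean_space set \<Rightarrow> ('a \<Rightarrow> 'b::real_normed_vector) \<Rightarrow> bool" where
  "Ck_on 0 S f \<longleftrightarrow> continuous_on S f"
| "Ck_on (Suc k) S f \<longleftrightarrow> f differentiable_on S \<and> (\<forall>b\<in>Basis. Ck_on k S (partial_on S b f))"

definition smooth_on :: "'a::euclidean_space set \<Rightarrow> ('a \<Rightarrow> 'b::real_normed_vector) \<Rightarrow> bool" where
  "smooth_on S f \<longleftrightarrow> (\<forall>k. Ck_on k S f)"

definition boundary_restriction ::
    "((real ^ 'm::finite) \<times> real \<Rightarrow> complex ^ 's::finite) \<Rightarrow> real ^ 'm \<Rightarrow> complex ^ 's" where
  "boundary_restriction \<psi> = (\<lambda>y. \<psi> (y, 0))"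

definition normal_derivative ::
    "((real ^ 'm::finite) \<times> real \<Rightarrow> complex ^ 's::finite) \<Rightarrow> (real ^ 'm) \<times> real \<Rightarrow> complex ^ 's" where
  "normal_derivative = partial_on halfspace (0, 1)"

definition tangential_dirac ::
    "('m::finite option \<Rightarrow> complex ^ 's ^ 's::finite) \<Rightarrow>
     (real ^ 'm \<Rightarrow> complex ^ 's) \<Rightarrow> real ^ 'm \<Rightarrow> complex ^ 's" where
  "tangential_dirac e \<phi> = (\<lambda>y. \<Sum>i\<in>UNIV. e (Some i) *v partial_on UNIV (axis i 1) \<phi> y)"

definition dirac_tilde ::
    "('m::finite option \<Rightarrow> complex ^ 's ^ 's::finite) \<Rightarrow>
     (real ^ 'm \<Rightarrow> complex ^ 's) \<Rightarrow> real ^ 'm \<Rightarrow> complex ^ 's" where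
  "dirac_tilde e \<phi> = (\<lambda>y. e None *v tangential_dirac e \<phi> y)"

text \<open>\<open>\<T>\<^sub>j(h;\<mu>)\<close>; for \<open>j = 2l\<close> and \<open>j = 2l + 1\<close> the number \<open>(j + 1) div 2\<close> is \<open>l\<close> and \<open>l + 1\<close>.\<close>

definition solution_op ::
    "('m::finite option \<Rightarrow> complex ^ 's ^ 's::finite) \<Rightarrow> nat \<Rightarrow> complex \<Rightarrow>
     (real ^ 'm \<Rightarrow> complex ^ 's) \<Rightarrow> real ^ 'm \<Rightarrow> complex ^ 's" where
  "solution_op e j \<mu> \<phi> = (\<lambda>y.
     (1 / (2 ^ j * fact (j div 2) * pochhammer (1/2 + \<mu>) ((j + 1) div 2))) *s
       (dirac_tilde e ^^ j) \<phi> y)"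

lemma solution_op_even:
  "solution_op e (2 * l) \<mu> \<phi> =
     (\<lambda>y. (1 / (2 ^ (2 * l) * fact l * pochhammer (1/2 + \<mu>) l)) *s (dirac_tilde e ^^ (2 * l)) \<phi> y)"
  by (simp add: solution_op_def)

lemma solution_op_odd:
  "solution_op e (2 * l + 1) \<mu> \<phi> =
     (\<lambda>y. (1 / (2 ^ (2 * l + 1) * fact l * pochhammer (1/2 + \<mu>) (l + 1))) *s
            (dirac_tilde e ^^ (2 * l + 1)) \<phi> y)"
  by (simp add: solution_op_def)

definition delta_family ::
    "('m::finite option \<Rightarrow> complex ^ 's ^ 's::finite) \<Rightarrow> nat \<Rightarrow> complex \<Rightarrow>
     ((real ^ 'm) \<times> real \<Rightarrow> complex ^ 's) \<Rightarrow> real ^ 'm \<Rightarrow> complex ^ 's" where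
  "delta_family e k \<mu> \<psi> = (\<lambda>y. \<Sum>j=0..k.
     (1 / fact (k - j)) *s
       solution_op e j \<mu> (boundary_restriction ((normal_derivative ^^ (k - j)) \<psi>)) y)"

text \<open>
  The product of the prefactor and \<open>\<delta>\<^sub>k\<close>, with the value of \<open>\<delta>\<^sub>k\<close> at a pole given by the
  convention \<open>1 / 0 = 0\<close>. The upper limit \<open>(k + 1) div 2\<close> is \<open>N\<close> for \<open>k = 2N\<close> and \<open>N + 1\<close> for
  \<open>k = 2N + 1\<close>.
\<close>

definition residue_family_raw ::
    "nat \<Rightarrow> ('m::finite option \<Rightarrow> complex ^ 's ^ 's::finite) \<Rightarrow> nat \<Rightarrow> complex \<Rightarrow>
     ((real ^ 'm) \<times> real \<Rightarrow> complex ^ 's) \<Rightarrow> real ^ 'm \<Rightarrow> complex ^ 's" where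
  "residue_family_raw n e k \<mu> \<psi> = (\<lambda>y.
     (2 ^ k * fact (k div 2) * (\<Prod>i<(k + 1) div 2. \<mu> + of_nat n / 2 - of_nat k + of_nat i)) *s
       delta_family e k (\<mu> + (of_nat n - 1) / 2 - of_nat k) \<psi> y)"

lemma residue_family_raw_even:
  "residue_family_raw n e (2 * N) \<mu> \<psi> = (\<lambda>y.
     (2 ^ (2 * N) * fact N * (\<Prod>i<N. \<mu> + of_nat n / 2 - 2 * of_nat N + of_nat i)) *s
       delta_family e (2 * N) (\<mu> + (of_nat n - 1) / 2 - 2 * of_nat N) \<psi> y)"
  by (simp add: residue_family_raw_def)

lemma residue_family_raw_odd:
  "residue_family_raw n e (2 * N + 1) \<mu> \<psi> = (\<lambda>y.
     (2 ^ (2 * N + 1) * fact N *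
        (\<Prod>i\<le>N. \<mu> + of_nat n / 2 - 2 * of_nat N - 1 + of_nat i)) *s
       delta_family e (2 * N + 1) (\<mu> + (of_nat n - 1) / 2 - 2 * of_nat N - 1) \<psi> y)"
  by (simp add: residue_family_raw_def lessThan_Suc_atMost algebra_simps)

text \<open>The value at \<open>z\<close> of the unique polynomial that agrees with \<open>F\<close> up to finitely many points.\<close>

definition poly_continuation :: "(complex \<Rightarrow> complex ^ 's::finite) \<Rightarrow> complex \<Rightarrow> complex ^ 's" where
  "poly_continuation F z = (\<chi> i. poly (THE p. finite {w. poly p w \<noteq> F w $ i}) z)"

definition residue_family ::
    "nat \<Rightarrow> ('m::finite option \<Rightarrow> complex ^ 's ^ 's::finite) \<Rightarrow> nat \<Rightarrow> complex \<Rightarrow>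
     ((real ^ 'm) \<times> real \<Rightarrow> complex ^ 's) \<Rightarrow> real ^ 'm \<Rightarrow> complex ^ 's" where
  "residue_family n e k \<mu> \<psi> = (\<lambda>y. poly_continuation (\<lambda>w. residue_family_raw n e k w \<psi> y) \<mu>)"

lemma poly_continuation_eqI:
  assumes "\<And>i. finite {w. poly (p i) w \<noteq> F w $ i}"
  shows "poly_continuation F z = (\<chi> i. poly (p i) z)"
proof -
  have "(THE q. finite {w. poly q w \<noteq> F w $ i}) = p i" for i
  proof (rule the_equality)
    fix q assume "finite {w. poly q w \<noteq> F w $ i}"
    then have "finite ({w. poly q w \<noteq> F w $ i} \<union> {w. poly (p i) w \<noteq> F w $ i})"
      using assms by blast
    then have fin: "finite {w. poly (q - p i) w \<noteq> 0}"
      by (rule rev_finite_subset) auto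
    show "q = p i"
    proof (rule ccontr)
      assume "q \<noteq> p i"
      then have "finite {w. poly (q - p i) w = 0}" by (intro poly_roots_finite) auto
      with fin have "finite ({w. poly (q - p i) w \<noteq> 0} \<union> {w. poly (q - p i) w = 0})" by blast
      moreover have "{w. poly (q - p i) w \<noteq> 0} \<union> {w. poly (q - p i) w = 0} = UNIV" by auto
      ultimately show False using infinite_UNIV_char_0[where 'a=complex] by metis
    qed
  qed (fact assms)
  then show ?thesis by (simp add: poly_continuation_def)
qed

lemma poly_pochhammer: "poly (pochhammer p r) z = pochhammer (poly p z) r"
  by (simp add: pochhammer_prod poly_prod)

text \<open>The polynomial continuation exists, and off the poles it is the defining product.\<close>

lemma residue_family_explicit:
  "residue_family n e k \<mu> \<psi> y =
     (\<Sum>j=0..k. (2 ^ k * fact (k div 2) / (fact (k - j) * 2 ^ j * fact (j div 2)) *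
        pochhammer (\<mu> + of_nat n / 2 - of_nat k + of_nat ((j + 1) div 2))
          ((k + 1) div 2 - (j + 1) div 2)) *s
        (dirac_tilde e ^^ j) (boundary_restriction ((normal_derivative ^^ (k - j)) \<psi>)) y)"
  (is "_ = ?R \<mu>")
  and residue_family_eq_raw:
  "pochhammer (\<mu> + of_nat n / 2 - of_nat k) ((k + 1) div 2) \<noteq> 0 \<Longrightarrow>
     residue_family n e k \<mu> \<psi> y = residue_family_raw n e k \<mu> \<psi> y"
proof -
  define m where "m = (k + 1) div 2"
  define u where "u j = (dirac_tilde e ^^ j) (boundary_restriction ((normal_derivative ^^ (k - j)) \<psi>)) y" for j
  define c :: "nat \<Rightarrow> complex"
    where "c j = 2 ^ k * fact (k div 2) / (fact (k - j) * 2 ^ j * fact (j div 2))" for j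
  define a :: complex where "a = of_nat n / 2 - of_nat k"
  define p where "p i = (\<Sum>j=0..k. smult (c j * u j $ i)
     (pochhammer [:a + of_nat ((j + 1) div 2), 1:] (m - (j + 1) div 2)))" for i
  have R: "?R z = (\<chi> i. poly (p i) z)" for z
    by (auto simp: vec_eq_iff p_def poly_sum poly_pochhammer c_def u_def m_def a_def
        algebra_simps intro!: sum.cong)
  have raw: "residue_family_raw n e k z \<psi> y = ?R z"
    if nz: "pochhammer (z + of_nat n / 2 - of_nat k) m \<noteq> 0" for z
  proof -
    define x where "x = z + of_nat n / 2 - of_nat k"
    have prod: "(\<Prod>i<m. x + of_nat i) = pochhammer x m"
      by (simp add: pochhammer_prod lessThan_atLeast0)
    have x: "1 / 2 + (z + (of_nat n - 1) / 2 - of_nat k) = x"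
      by (simp add: x_def field_simps)
    have split: "pochhammer x m =
        pochhammer x ((j + 1) div 2) * pochhammer (x + of_nat ((j + 1) div 2)) (m - (j + 1) div 2)"
      if "j \<le> k" for j
      using that by (intro pochhammer_product) (simp add: m_def div_le_mono)
    have nz2: "pochhammer x ((j + 1) div 2) \<noteq> 0" if "j \<le> k" for j
      using split[OF that] nz by (auto simp: x_def)
    show ?thesis
      unfolding residue_family_raw_def delta_family_def solution_op_def
        m_def[symmetric] prod x u_def[symmetric] x_def[symmetric]
      unfolding vec_eq_iff sum_component vector_smult_component sum_distrib_left
    proof (intro allI sum.cong refl)
      fix i j assume "j \<in> {0..k}"
      then have "j \<le> k" by simp
      then show "2 ^ k * fact (k div 2) * pochhammer x m *
          (1 / fact (k - j) * (1 / (2 ^ j * fact (j div 2) * pochhammer x ((j + 1) div 2)) * u j $ i)) =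
        2 ^ k * fact (k div 2) / (fact (k - j) * 2 ^ j * fact (j div 2)) *
          pochhammer (x + of_nat ((j + 1) div 2)) (m - (j + 1) div 2) * u j $ i"
        using nz2[of j] unfolding split[OF \<open>j \<le> k\<close>] by (simp add: field_simps)
    qed
  qed
  have fin: "finite {w. poly (p i) w \<noteq> residue_family_raw n e k w \<psi> y $ i}" for i
  proof (rule finite_subset)
    show "{w. poly (p i) w \<noteq> residue_family_raw n e k w \<psi> y $ i} \<subseteq>
        {w. poly (pochhammer [:a, 1:] m) w = 0}"
    proof safe
      fix w assume ne: "poly (p i) w \<noteq> residue_family_raw n e k w \<psi> y $ i"
      have "pochhammer (w + of_nat n / 2 - of_nat k) m = 0"
      proof (rule ccontr)
        assume "pochhammer (w + of_nat n / 2 - of_nat k) m \<noteq> 0"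
        from raw[OF this] R[of w] ne show False by simp
      qed
      then show "poly (pochhammer [:a, 1:] m) w = 0"
        by (simp add: poly_pochhammer a_def algebra_simps)
    qed
    have "pochhammer [:a, 1:] m \<noteq> 0"
      by (auto simp: pochhammer_prod of_nat_poly)
    then show "finite {w. poly (pochhammer [:a, 1:] m) w = 0}"
      by (rule poly_roots_finite)
  qed
  show main: "residue_family n e k \<mu> \<psi> y = ?R \<mu>"
    unfolding residue_family_def R by (rule poly_continuation_eqI) (rule fin)
  show "residue_family n e k \<mu> \<psi> y = residue_family_raw n e k \<mu> \<psi> y"
    if "pochhammer (\<mu> + of_nat n / 2 - of_nat k) ((k + 1) div 2) \<noteq> 0"
    using raw that unfolding main m_def by simp
qed

lemma residue_family_0: "residue_family n e 0 \<mu> = boundary_restriction"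
  by (intro ext) (simp add: residue_family_explicit)

end

theory Submission
  imports Defs
begin

text \<open>
  At \<open>\<lambda> = k - n/2 - M\<close> the coefficient of the \<open>j\<close>-th summand of the residue family of order
  \<open>k\<close> contains the Pochhammer symbol \<open>(\<lceil>j/2\<rceil> - M)\<^sub>r\<close> with \<open>r = \<lceil>k/2\<rceil> - \<lceil>j/2\<rceil>\<close>, which vanishes for
  \<open>j \<le> 2M\<close>. The remaining summands contain at least \<open>2M + 1\<close> factors \<open>e\<^sub>n \<cdot> D\<^sub>\<T>\<close>, and since \<open>e\<^sub>n\<close>
  anticommutes with \<open>D\<^sub>\<T>\<close> and squares to \<open>-1\<close>, the first \<open>2M + 1\<close> of them compose to
  \<open>e\<^sub>n \<cdot> D\<^sub>\<T>\<^bsup>2M+1\<^esup>\<close>. The coefficients left over are those of the family of order \<open>k - 2M - 1\<close> at the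
  same \<open>\<lambda>\<close>, because the Pochhammer symbols on both sides are quotients
  of the same factorials. The two parts of the theorem
  are the cases of even and odd \<open>k\<close>.
\<close>

section \<open>Directional derivatives and smoothness on the whole space\<close>

lemma smooth_on_partial_on:
  assumes "smooth_on S f" "b \<in> Basis"
  shows "smooth_on S (partial_on S b f)"
  unfolding smooth_on_def
proof
  fix k
  show "Ck_on k S (partial_on S b f)"
    using assms(1)[unfolded smooth_on_def, THEN spec, of "Suc k"] assms(2) by simp
qed

lemma smooth_on_UNIV_differentiable:
  assumes "smooth_on UNIV f"
  shows "f differentiable at x"
  using assms[unfolded smooth_on_def, THEN spec, of "Suc 0"]
  by (simp add: differentiable_on_def)

text \<open>\<open>vector_derivative\<close> returns some value even where no derivative exists.
  Differentiability makes \<open>partial_on\<close> a genuine derivative, and the calculus rules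
  below then follow by uniqueness of derivatives.\<close>

lemma differentiable_line_has_vector_derivative:
  fixes f :: "'a::real_normed_vector \<Rightarrow> 'b::real_normed_vector"
  assumes "f differentiable at x"
  shows "((\<lambda>t::real. f (x + t *\<^sub>R v)) has_vector_derivative partial_on UNIV v f x) (at 0)"
proof -
  have "f differentiable at (x + 0 *\<^sub>R v)" using assms by simp
  moreover have "(\<lambda>t::real. x + t *\<^sub>R v) differentiable at 0"
    by (auto simp: differentiable_def intro!: derivative_eq_intros)
  ultimately have "(f \<circ> (\<lambda>t. x + t *\<^sub>R v)) differentiable at 0"
    by (intro differentiable_chain_at) simp_all
  then show ?thesis
    by (simp add: partial_on_def o_def vector_derivative_works)
qed

lemma partial_on_bounded_linear:
  fixes f :: "'a::real_normed_vector \<Rightarrow> 'b::real_normed_vector"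
  assumes "bounded_linear A" "f differentiable at x"
  shows "partial_on UNIV v (\<lambda>x. A (f x)) x = A (partial_on UNIV v f x)"
  using bounded_linear.has_vector_derivative[OF assms(1)
      differentiable_line_has_vector_derivative[OF assms(2)]]
  by (simp add: partial_on_def vector_derivative_at)

lemma partial_on_add:
  fixes f g :: "'a::real_normed_vector \<Rightarrow> 'b::real_normed_vector"
  assumes "f differentiable at x" "g differentiable at x"
  shows "partial_on UNIV v (\<lambda>x. f x + g x) x = partial_on UNIV v f x + partial_on UNIV v g x"
  using has_vector_derivative_add[OF assms[THEN differentiable_line_has_vector_derivative]]
  by (simp add: partial_on_def vector_derivative_at)

lemma partial_on_zero: "partial_on UNIV v (\<lambda>x. 0) = (\<lambda>x. 0)"
  by (simp add: partial_on_def fun_eq_iff vector_derivative_at)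

lemma Ck_on_bounded_linear:
  assumes "bounded_linear A" "Ck_on k UNIV f"
  shows "Ck_on k UNIV (\<lambda>x. A (f x))"
  using assms(2)
proof (induction k arbitrary: f)
  case 0
  then show ?case
    using assms(1) by (simp add: bounded_linear.continuous_on)
next
  case (Suc k)
  then have d: "f differentiable at x" for x by (simp add: differentiable_on_def)
  have "(\<lambda>x. A (f x)) differentiable at x" for x
    using d[of x] bounded_linear.has_derivative[OF assms(1)]
    unfolding differentiable_def by blast
  moreover have "partial_on UNIV b (\<lambda>x. A (f x)) = (\<lambda>x. A (partial_on UNIV b f x))" for b
    using partial_on_bounded_linear[OF assms(1) d] by blast
  ultimately show ?case using Suc by (simp add: differentiable_on_def)
qed

lemma Ck_on_add:
  assumes "Ck_on k UNIV f" "Ck_on k UNIV g"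
  shows "Ck_on k UNIV (\<lambda>x. f x + g x)"
  using assms
proof (induction k arbitrary: f g)
  case 0
  then show ?case by (simp add: continuous_on_add)
next
  case (Suc k)
  then have d: "f differentiable at x" "g differentiable at x" for x
    by (simp_all add: differentiable_on_def)
  have "partial_on UNIV b (\<lambda>x. f x + g x) =
      (\<lambda>x. partial_on UNIV b f x + partial_on UNIV b g x)" for b
    using partial_on_add[OF d] by blast
  then show ?case using Suc by (simp add: differentiable_on_def)
qed

lemma Ck_on_zero: "Ck_on k UNIV (\<lambda>x. 0)"
  by (induction k) (simp_all add: partial_on_zero)

lemma smooth_on_bounded_linear:
  assumes "bounded_linear A" "smooth_on UNIV f"
  shows "smooth_on UNIV (\<lambda>x. A (f x))"
  using assms by (simp add: smooth_on_def Ck_on_bounded_linear)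

lemma smooth_on_add:
  assumes "smooth_on UNIV f" "smooth_on UNIV g"
  shows "smooth_on UNIV (\<lambda>x. f x + g x)"
  using assms by (simp add: smooth_on_def Ck_on_add)

lemma smooth_on_sum:
  assumes "\<And>i. i \<in> I \<Longrightarrow> smooth_on UNIV (f i)"
  shows "smooth_on UNIV (\<lambda>x. \<Sum>i\<in>I. f i x)"
  using assms
proof (induction I rule: infinite_finite_induct)
  case (insert i I)
  then show ?case by (simp add: smooth_on_add)
qed (simp_all add: smooth_on_def Ck_on_zero)

text \<open>Derivatives here are taken over the reals, so a complex matrix enters as a real-linear
  map, which is bounded because the dimension is finite.\<close>

lemma bounded_linear_matrix_vector_mult:
  fixes A :: "complex ^ 'a ^ 'b"
  shows "bounded_linear ((*v) A)"
proof -
  have "linear ((*v) A)"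
    by (intro linearI)
      (simp_all add: vec_eq_iff matrix_vector_mult_def algebra_simps sum.distrib scaleR_sum_right)
  then show ?thesis by (simp add: linear_conv_bounded_linear)
qed

lemma bounded_linear_vector_scalar_mult: "bounded_linear ((*s) c :: complex ^ 'a \<Rightarrow> _)"
proof -
  have "linear ((*s) c :: complex ^ 'a \<Rightarrow> _)"
    by (intro linearI) (simp_all add: vec_eq_iff algebra_simps)
  then show ?thesis by (simp add: linear_conv_bounded_linear)
qed

section \<open>Normal derivatives and restriction to the boundary\<close>

lemma smooth_on_normal_derivative:
  assumes "smooth_on halfspace \<psi>"
  shows "smooth_on halfspace (normal_derivative \<psi>)"
  unfolding normal_derivative_def
  by (intro smooth_on_partial_on assms) (simp add: Basis_prod_def)

lemma smooth_on_normal_derivative_power: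
  "smooth_on halfspace \<psi> \<Longrightarrow> smooth_on halfspace ((normal_derivative ^^ i) \<psi>)"
  by (induction i) (simp_all add: smooth_on_normal_derivative)

text \<open>A line in a tangential direction through a boundary point never leaves the half-space,
  so the set of admissible parameters is all of the reals and both sides are the same two-sided
  derivative.\<close>

lemma partial_on_boundary_restriction:
  "partial_on UNIV b (boundary_restriction \<psi>) =
     boundary_restriction (partial_on halfspace (b, 0) \<psi>)"
  by (simp add: fun_eq_iff partial_on_def boundary_restriction_def halfspace_def)

lemma Ck_on_boundary_restriction:
  fixes \<psi> :: "(real ^ 'm::finite) \<times> real \<Rightarrow> complex ^ 's::finite"
  assumes "Ck_on k halfspace \<psi>"
  shows "Ck_on k UNIV (boundary_restriction \<psi>)"
  using assms
proof (induction k arbitrary: \<psi>)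
  case 0
  then have "continuous_on halfspace \<psi>" by simp
  then have "continuous_on UNIV (\<lambda>y. \<psi> (y, 0))"
    by (rule continuous_on_compose2) (auto simp: halfspace_def intro!: continuous_intros)
  then show ?case by (simp add: boundary_restriction_def)
next
  case (Suc k)
  have "boundary_restriction \<psi> differentiable at y" for y
  proof -
    have "\<psi> differentiable at (y, 0) within halfspace"
      using Suc.prems by (simp add: differentiable_on_def halfspace_def)
    \<comment> \<open>Nothing is known about \<open>\<psi>\<close> outside the half-space, so the
      chain rule is applied within the image of the inclusion
      \<open>y \<mapsto> (y, 0)\<close>.\<close>
    then have "\<psi> differentiable at (y, 0) within range (\<lambda>y. (y, 0))"
      by (rule differentiable_subset) (auto simp: halfspace_def)
    moreover have "(\<lambda>y. (y, 0::real)) differentiable at y"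
      by (auto simp: differentiable_def intro!: derivative_eq_intros)
    ultimately show ?thesis
      unfolding boundary_restriction_def by (rule differentiable_in_compose)
  qed
  moreover have "(b, 0::real) \<in> Basis" if "b \<in> Basis" for b :: "real ^ 'm"
    using that by (simp add: Basis_prod_def)
  ultimately show ?case
    using Suc by (simp add: partial_on_boundary_restriction differentiable_on_def)
qed

lemma smooth_on_boundary_restriction:
  "smooth_on halfspace \<psi> \<Longrightarrow> smooth_on UNIV (boundary_restriction \<psi>)"
  by (simp add: smooth_on_def Ck_on_boundary_restriction)

section \<open>Smoothness and complex linearity of the Dirac operators\<close>

lemma smooth_on_tangential_dirac:
  assumes "smooth_on UNIV \<phi>"
  shows "smooth_on UNIV (tangential_dirac e \<phi>)"
proof -
  have "smooth_on UNIV (\<lambda>y. e (Some i) *v partial_on UNIV (axis i 1) \<phi> y)" for i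
    by (rule smooth_on_bounded_linear[OF bounded_linear_matrix_vector_mult
          smooth_on_partial_on[OF assms]]) (simp add: axis_in_Basis_iff)
  then show ?thesis
    unfolding tangential_dirac_def by (intro smooth_on_sum)
qed

lemma smooth_on_tangential_dirac_power:
  "smooth_on UNIV \<phi> \<Longrightarrow> smooth_on UNIV ((tangential_dirac e ^^ i) \<phi>)"
  by (induction i) (simp_all add: smooth_on_tangential_dirac)

lemma smooth_on_dirac_tilde_power:
  "smooth_on UNIV \<phi> \<Longrightarrow> smooth_on UNIV ((dirac_tilde e ^^ i) \<phi>)"
proof (induction i)
  case (Suc i)
  then show ?case
    by (simp add: dirac_tilde_def smooth_on_tangential_dirac
        smooth_on_bounded_linear[OF bounded_linear_matrix_vector_mult])
qed simp

lemma tangential_dirac_scalar: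
  assumes "smooth_on UNIV \<phi>"
  shows "tangential_dirac e (\<lambda>y. c *s \<phi> y) = (\<lambda>y. c *s tangential_dirac e \<phi> y)"
proof -
  have "partial_on UNIV b (\<lambda>y. c *s \<phi> y) y = c *s partial_on UNIV b \<phi> y" for b y
    by (intro partial_on_bounded_linear bounded_linear_vector_scalar_mult
        smooth_on_UNIV_differentiable assms)
  then show ?thesis
    by (simp add: tangential_dirac_def vector_scalar_commute fun_eq_iff vec.scale_sum_right)
qed

lemma tangential_dirac_add:
  assumes "smooth_on UNIV f" "smooth_on UNIV g"
  shows "tangential_dirac e (\<lambda>y. f y + g y) =
    (\<lambda>y. tangential_dirac e f y + tangential_dirac e g y)"
  using partial_on_add[OF assms[THEN smooth_on_UNIV_differentiable]]
  by (simp add: tangential_dirac_def fun_eq_iff matrix_vector_right_distrib sum.distrib)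

lemma tangential_dirac_sum:
  assumes "\<And>i. i \<in> I \<Longrightarrow> smooth_on UNIV (f i)"
  shows "tangential_dirac e (\<lambda>y. \<Sum>i\<in>I. f i y) = (\<lambda>y. \<Sum>i\<in>I. tangential_dirac e (f i) y)"
  using assms
proof (induction I rule: infinite_finite_induct)
  case (insert i I)
  then show ?case by (simp add: smooth_on_sum tangential_dirac_add)
qed (simp_all add: tangential_dirac_def partial_on_zero)

text \<open>This pulls the power of the tangential Dirac operator out of the finite sum that expands
  a residue family.\<close>

lemma tangential_dirac_power_linear_combination:
  assumes "\<And>i. i \<in> I \<Longrightarrow> smooth_on UNIV (f i)"
  shows "(tangential_dirac e ^^ k) (\<lambda>y. \<Sum>i\<in>I. c i *s f i y) =
    (\<lambda>y. \<Sum>i\<in>I. c i *s (tangential_dirac e ^^ k) (f i) y)"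
proof (induction k)
  case (Suc k)
  have "smooth_on UNIV (\<lambda>y. c i *s (tangential_dirac e ^^ k) (f i) y)" if "i \<in> I" for i
    by (rule smooth_on_bounded_linear[OF bounded_linear_vector_scalar_mult
          smooth_on_tangential_dirac_power[OF assms[OF that]]])
  then show ?case
    by (simp add: Suc tangential_dirac_sum tangential_dirac_scalar
        smooth_on_tangential_dirac_power assms)
qed simp

section \<open>Clifford relations and powers of \<open>dirac_tilde\<close>\<close>

lemma spinor_module_square:
  assumes "spinor_module n e"
  shows "e i *v (e i *v v) = - v"
proof -
  have "e i ** e i + e i ** e i = mat (- 2)"
    using assms by (simp add: spinor_module_def)
  then have "(e i ** e i + e i ** e i) *v v = mat (- 2) *v v"
    by simp
  also have "mat (- 2) *v v = - (v + v)"
    by (simp add: vec_eq_iff matrix_vector_mult_def mat_def if_distrib[of "\<lambda>x. x * _"] cong: if_cong)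
  finally have "e i *v (e i *v v) + e i *v (e i *v v) = - v + - v"
    by (simp only: matrix_vector_mult_add_rdistrib matrix_vector_mul_assoc minus_add_distrib)
  then show ?thesis
    by (simp only: scaleR_2[symmetric] scaleR_cancel_left) simp
qed

lemma spinor_module_anticommute:
  assumes "spinor_module n e" "i \<noteq> j"
  shows "e i *v (e j *v v) = - (e j *v (e i *v v))"
proof -
  have "e i ** e j + e j ** e i = mat 0"
    using assms by (simp add: spinor_module_def)
  then have "(e i ** e j + e j ** e i) *v v = mat 0 *v v"
    by simp
  then show ?thesis
    by (simp add: matrix_vector_mult_add_rdistrib matrix_vector_mul_assoc eq_neg_iff_add_eq_0)
qed

text \<open>Write \<open>D\<close> for \<open>tangential_dirac e\<close>. The constant matrix
  \<open>e None\<close> commutes with partial derivatives and anticommutes with each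
  \<open>e (Some i)\<close>, so moving it past \<open>D\<close> costs one sign; its square
  \<open>-1\<close> gives the second, and the two cancel.\<close>

lemma dirac_tilde_twice:
  assumes "spinor_module n e" "smooth_on UNIV \<phi>"
  shows "dirac_tilde e (dirac_tilde e \<phi>) = tangential_dirac e (tangential_dirac e \<phi>)"
proof
  fix y
  note linear = bounded_linear.linear[OF bounded_linear_matrix_vector_mult]
  define \<xi> where "\<xi> = tangential_dirac e \<phi>"
  have "smooth_on UNIV \<xi>"
    by (simp add: \<xi>_def assms smooth_on_tangential_dirac)
  then have "partial_on UNIV b (\<lambda>y. e None *v \<xi> y) y = e None *v partial_on UNIV b \<xi> y" for b
    by (intro partial_on_bounded_linear bounded_linear_matrix_vector_mult
        smooth_on_UNIV_differentiable)
  moreover have "e (Some i) *v (e None *v v) = - (e None *v (e (Some i) *v v))" for i v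
    using assms(1) by (rule spinor_module_anticommute) simp
  ultimately have "tangential_dirac e (\<lambda>y. e None *v \<xi> y) y =
      (\<Sum>i\<in>UNIV. - (e None *v (e (Some i) *v partial_on UNIV (axis i 1) \<xi> y)))"
    by (simp add: tangential_dirac_def)
  also have "\<dots> = e None *v (- tangential_dirac e \<xi> y)"
    by (simp add: tangential_dirac_def sum_negf linear_sum[OF linear] linear_neg[OF linear])
  finally have "dirac_tilde e (dirac_tilde e \<phi>) y = - (- tangential_dirac e \<xi> y)"
    unfolding dirac_tilde_def \<xi>_def[symmetric] by (simp only: spinor_module_square[OF assms(1)])
  then show "dirac_tilde e (dirac_tilde e \<phi>) y = tangential_dirac e (tangential_dirac e \<phi>) y"
    by (simp add: \<xi>_def)
qed

lemma dirac_tilde_power_odd: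
  assumes "spinor_module n e" "smooth_on UNIV \<phi>"
  shows "(dirac_tilde e ^^ (2 * M + 1)) \<phi> =
    (\<lambda>y. e None *v (tangential_dirac e ^^ (2 * M + 1)) \<phi> y)"
proof -
  \<comment> \<open>Even powers of both operators agree pair by pair; the one remaining outer factor
    contributes the single \<open>e None\<close>.\<close>
  have "(dirac_tilde e ^^ (2 * M)) \<phi> = (tangential_dirac e ^^ (2 * M)) \<phi>"
  proof (induction M)
    case (Suc M)
    have "(dirac_tilde e ^^ (2 * Suc M)) \<phi> =
        dirac_tilde e (dirac_tilde e ((tangential_dirac e ^^ (2 * M)) \<phi>))"
      using Suc by simp
    also have "\<dots> = (tangential_dirac e ^^ (2 * Suc M)) \<phi>"
      by (simp add: dirac_tilde_twice[OF assms(1) smooth_on_tangential_dirac_power[OF assms(2)]])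
    finally show ?case .
  qed simp
  then show ?thesis by (simp add: dirac_tilde_def)
qed

section \<open>Coefficients of the residue families\<close>

lemma pochhammer_Suc_fact:
  assumes "a \<le> b"
  shows "pochhammer (1 + of_nat a) (b - a) = (fact b / fact a :: 'a::field_char_0)"
  using pochhammer_product[OF assms, of "1 :: 'a"]
  by (simp add: pochhammer_fact[symmetric])

text \<open>The coefficient from \<open>residue_family_explicit\<close> in the variable
  \<open>x = \<mu> + n/2 - k\<close>, in which the critical values of \<open>\<mu>\<close> become
  integers.\<close>

definition residue_coeff :: "nat \<Rightarrow> nat \<Rightarrow> complex \<Rightarrow> complex" where
  "residue_coeff k j x = 2 ^ k * fact (k div 2) / (fact (k - j) * 2 ^ j * fact (j div 2)) *
     pochhammer (x + of_nat ((j + 1) div 2)) ((k + 1) div 2 - (j + 1) div 2)"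

text \<open>With \<open>p = M - (j + 1) div 2\<close> the Pochhammer symbol starts at the
  nonpositive integer \<open>-p\<close> and has more than \<open>p\<close> factors, so one of them
  is zero.\<close>

lemma residue_coeff_eq_0:
  assumes "j \<le> 2 * M" "2 * M + 1 \<le> k"
  shows "residue_coeff k j (- of_nat M) = 0"
proof -
  have le: "(j + 1) div 2 \<le> M" and "M < (k + 1) div 2" using assms by auto
  then have "pochhammer (- of_nat (M - (j + 1) div 2) :: complex) ((k + 1) div 2 - (j + 1) div 2) = 0"
    by (simp only: pochhammer_of_nat_eq_0_iff)
  also have "- of_nat (M - (j + 1) div 2) = - of_nat M + (of_nat ((j + 1) div 2) :: complex)"
    by (simp only: of_nat_diff[OF le]) simp
  finally show ?thesis by (simp only: residue_coeff_def mult_zero_right)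
qed

text \<open>Adding the odd number \<open>2 * M + 1\<close> interchanges rounding down and rounding
  up of halves. Hence the Pochhammer symbol on each side equals the quotient of factorials standing
  explicitly on the other, while \<open>k - j\<close> and the net power of 2 are unchanged.\<close>

lemma residue_coeff_shift:
  assumes "2 * M + 1 + i \<le> k"
  shows "residue_coeff k (i + (2 * M + 1)) (- of_nat M) =
    residue_coeff (k - (2 * M + 1)) i (1 + of_nat M)"
proof -
  obtain l where k: "k = l + (2 * M + 1)" and "i \<le> l"
    using assms by (metis add.commute add_le_cancel_left le_Suc_ex le_add1 order_trans)
  have div: "(l + (2 * M + 1)) div 2 = (l + 1) div 2 + M"
    "(l + (2 * M + 1) + 1) div 2 = l div 2 + 1 + M" for l by auto
  have le: "i div 2 \<le> l div 2" "(i + 1) div 2 \<le> (l + 1) div 2"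
    using \<open>i \<le> l\<close> by (simp_all add: div_le_mono)
  have 1: "pochhammer (1 + complex_of_nat (i div 2)) (l div 2 - i div 2) =
      fact (l div 2) / fact (i div 2)"
    using le(1) by (rule pochhammer_Suc_fact)
  have 2: "pochhammer (1 + complex_of_nat ((i + 1) div 2 + M)) ((l + 1) div 2 - (i + 1) div 2) =
      fact ((l + 1) div 2 + M) / fact ((i + 1) div 2 + M)"
    using pochhammer_Suc_fact[of "(i + 1) div 2 + M" "(l + 1) div 2 + M", where 'a = complex] le(2)
    by simp
  have x: "- complex_of_nat M + of_nat (i div 2 + 1 + M) = 1 + of_nat (i div 2)"
    "1 + complex_of_nat M + of_nat ((i + 1) div 2) = 1 + of_nat ((i + 1) div 2 + M)"
    by simp_all
  have y: "l div 2 + 1 + M - (i div 2 + 1 + M) = l div 2 - i div 2"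
    "l + (2 * M + 1) - (i + (2 * M + 1)) = l - i" "l + (2 * M + 1) - (2 * M + 1) = l"
    by simp_all
  show ?thesis
    unfolding residue_coeff_def k y div x 1 2 by (simp add: power_add mult_ac)
qed

section \<open>The factorization for orders of either parity\<close>

lemma residue_family_factorization:
  fixes e :: "'m::finite option \<Rightarrow> complex ^ 's ^ 's::finite"
  assumes "spinor_module n e" "smooth_on halfspace \<psi>" "2 * M + 1 \<le> k"
    and \<mu>: "\<mu> = of_nat k - of_nat n / 2 - of_nat M"
  shows "residue_family n e k \<mu> \<psi> =
    (\<lambda>y. e None *v (tangential_dirac e ^^ (2 * M + 1))
       (residue_family n e (k - (2 * M + 1)) \<mu> \<psi>) y)"
proof
  fix y
  define r where "r = 2 * M + 1"
  define u where "u j = boundary_restriction ((normal_derivative ^^ (k - j)) \<psi>)" for j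
  have u: "smooth_on UNIV (u j)" for j
    unfolding u_def
    by (intro smooth_on_boundary_restriction smooth_on_normal_derivative_power assms)
  have r: "r \<le> k" using assms by (simp add: r_def)
  \<comment> \<open>The choice of \<open>\<mu>\<close> makes
    \<open>\<mu> + of_nat n / 2 - of_nat k\<close> equal to \<open>- of_nat M\<close>.\<close>
  have "residue_family n e k \<mu> \<psi> y =
      (\<Sum>j=0..k. residue_coeff k j (- of_nat M) *s (dirac_tilde e ^^ j) (u j) y)"
    by (simp add: residue_family_explicit residue_coeff_def u_def \<mu>)
  also have "\<dots> = (\<Sum>j=r..k. residue_coeff k j (- of_nat M) *s (dirac_tilde e ^^ j) (u j) y)"
    using assms(3) by (intro sum.mono_neutral_right) (auto simp: r_def residue_coeff_eq_0)
  also have "\<dots> = (\<Sum>i=0..k - r. residue_coeff k (i + r) (- of_nat M) *s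
      (dirac_tilde e ^^ (i + r)) (u (i + r)) y)"
    using sum.shift_bounds_cl_nat_ivl[of _ 0 r "k - r"] r by simp
  also have "\<dots> = (\<Sum>i=0..k - r. residue_coeff (k - r) i (1 + of_nat M) *s
      (e None *v (tangential_dirac e ^^ r) ((dirac_tilde e ^^ i) (u (i + r))) y))"
  proof (intro sum.cong refl)
    fix i assume "i \<in> {0..k - r}"
    then have "residue_coeff k (i + r) (- of_nat M) = residue_coeff (k - r) i (1 + of_nat M)"
      unfolding r_def using assms(3) by (intro residue_coeff_shift) auto
    moreover have "(dirac_tilde e ^^ (i + r)) (u (i + r)) =
        (\<lambda>y. e None *v (tangential_dirac e ^^ r) ((dirac_tilde e ^^ i) (u (i + r))) y)"
      \<comment> \<open>The \<open>r\<close> outer factors are split off and converted; the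
        \<open>i\<close> inner ones stay as \<open>dirac_tilde\<close> and produce the smooth
        section to which the odd-power rule applies.\<close>
      unfolding add.commute[of i r] funpow_add o_apply
      unfolding r_def using dirac_tilde_power_odd[OF assms(1) smooth_on_dirac_tilde_power[OF u]] .
    ultimately show "residue_coeff k (i + r) (- of_nat M) *s
        (dirac_tilde e ^^ (i + r)) (u (i + r)) y =
      residue_coeff (k - r) i (1 + of_nat M) *s
        (e None *v (tangential_dirac e ^^ r) ((dirac_tilde e ^^ i) (u (i + r))) y)"
      by simp
  qed
  also have "\<dots> = e None *v (\<Sum>i=0..k - r. residue_coeff (k - r) i (1 + of_nat M) *s
      (tangential_dirac e ^^ r) ((dirac_tilde e ^^ i) (u (i + r))) y)"
    by (simp add: linear_sum[OF bounded_linear.linear[OF bounded_linear_matrix_vector_mult]]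
        vector_scalar_commute)
  also have "\<dots> = e None *v (tangential_dirac e ^^ r) (\<lambda>y. \<Sum>i=0..k - r.
      residue_coeff (k - r) i (1 + of_nat M) *s (dirac_tilde e ^^ i) (u (i + r)) y) y"
    by (simp add: tangential_dirac_power_linear_combination smooth_on_dirac_tilde_power u)
  also have "(\<lambda>y. \<Sum>i=0..k - r. residue_coeff (k - r) i (1 + of_nat M) *s
      (dirac_tilde e ^^ i) (u (i + r)) y) = residue_family n e (k - r) \<mu> \<psi>"
  proof -
    \<comment> \<open>Lowering the order by \<open>r = 2 * M + 1\<close> at fixed
      \<open>\<mu>\<close> moves the argument from \<open>-M\<close> to \<open>1 + M\<close>. The
      sections match as well: \<open>u (i + r)\<close> carries
      \<open>k - (i + r) = (k - r) - i\<close> normal derivatives.\<close>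
    have "\<mu> + of_nat n / 2 - of_nat (k - r) = 1 + of_nat M"
      using r by (simp add: \<mu>) (simp add: r_def)
    then show ?thesis
      by (simp add: fun_eq_iff residue_family_explicit residue_coeff_def u_def add.commute)
  qed
  finally show "residue_family n e k \<mu> \<psi> y = e None *v (tangential_dirac e ^^ (2 * M + 1))
       (residue_family n e (k - (2 * M + 1)) \<mu> \<psi>) y"
    by (simp only: r_def)
qed

theorem theorem5p2:
  fixes n :: nat
    and e :: "'m::finite option \<Rightarrow> complex ^ 's ^ 's::finite"
    and \<psi> :: "(real ^ 'm) \<times> real \<Rightarrow> complex ^ 's"
  assumes "n \<ge> 2" and "CARD('m) = n - 1"
    and "spinor_module n e"
    and "smooth_on halfspace \<psi>"
  shows
    "(\<forall>N M :: nat. 1 \<le> N \<longrightarrow> M \<le> N - 1 \<longrightarrow>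
        residue_family n e (2 * N) (2 * of_nat N - of_nat n / 2 - of_nat M) \<psi> =
        (\<lambda>y. e None *v (tangential_dirac e ^^ (2 * M + 1))
           (residue_family n e (2 * N - 2 * M - 1) (2 * of_nat N - of_nat n / 2 - of_nat M) \<psi>) y)) \<and>
     (\<forall>N M :: nat. 1 \<le> N \<longrightarrow> M \<le> N \<longrightarrow>
        residue_family n e (2 * N + 1) (2 * of_nat N + 1 - of_nat n / 2 - of_nat M) \<psi> =
        (\<lambda>y. e None *v (tangential_dirac e ^^ (2 * M + 1))
           (residue_family n e (2 * N - 2 * M) (2 * of_nat N + 1 - of_nat n / 2 - of_nat M) \<psi>) y))"
proof (intro conjI allI impI)
  fix N M :: nat
  assume "1 \<le> N" "M \<le> N - 1"
  \<comment> \<open>Here \<open>1 \<le> N\<close> matters: for \<open>N = 0\<close> truncated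
    subtraction would admit \<open>M = 0\<close>.\<close>
  then have "2 * M + 1 \<le> 2 * N" by simp
  from residue_family_factorization[OF assms(3,4) this refl]
  show "residue_family n e (2 * N) (2 * of_nat N - of_nat n / 2 - of_nat M) \<psi> =
      (\<lambda>y. e None *v (tangential_dirac e ^^ (2 * M + 1))
         (residue_family n e (2 * N - 2 * M - 1) (2 * of_nat N - of_nat n / 2 - of_nat M) \<psi>) y)"
    by simp
next
  fix N M :: nat
  assume "1 \<le> N" "M \<le> N"
  then have "2 * M + 1 \<le> 2 * N + 1" by simp
  from residue_family_factorization[OF assms(3,4) this refl]
  show "residue_family n e (2 * N + 1) (2 * of_nat N + 1 - of_nat n / 2 - of_nat M) \<psi> =
      (\<lambda>y. e None *v (tangential_dirac e ^^ (2 * M + 1))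
         (residue_family n e (2 * N - 2 * M) (2 * of_nat N + 1 - of_nat n / 2 - of_nat M) \<psi>) y)"
    by (simp add: add.commute)
qed

end
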